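(* Let $d,m\ge1$ be integers, let $\phi:\mathbb{R}_{>0}\to\mathbb{R}_{>0}$ be a decreasing function, let $\bm{\theta}\in\mathbb{R}^{d+m}$, let $A=\begin{pmatrix}\bm{\beta}\\ A'\end{pmatrix}\in\mathbb{R}^{(d+1)\times m}$ with $\bm{\beta}\in\mathbb{R}^m$, $A'\in\mathbb{R}^{d\times m}$, and denote $C_{d,m}:=8^d\pi^{2m}$. (a) Suppose that $A$ is $\phi$-badly approximable. Then for any positive integer $Q$ and positive real number $\delta$ we have $$N_A(Q,\delta,\bm{\theta})\le C_{d+1,m}\,\delta^m\max\left\{Q,\frac{1}{\phi(\delta^{-1})}\right\}^{d+1}.$$ (b) If instead we assume the stronger condition that $A'$ is $\phi$-badly approximable, then for any positive integer $Q$ and positive real number $\delta$ $$N_A'(Q,\delta,\bm{\theta})\le C_{d,m}\,\delta^m\max\left\{Q,\frac{1}{\phi(\delta^{-1})}\right\}^{d}.$$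
   Context: Vectors are row vectors; $|\cdot|$ is the supremum norm; $\|\bm{y}\|$ is the sup-norm distance of $\bm{y}$ to the nearest integer vector (also for column vectors). "Decreasing" means non-increasing. A real matrix $B$ with $m$ columns is $\phi$-badly approximable if $\|B\bm{q}^{\mathrm T}\|\ge\phi(|\bm{q}|)$ for all nonzero $\bm{q}\in\mathbb{Z}^m$. Write $\bm{\theta}=(\bm{\theta}^{(1)},\bm{\theta}^{(2)})\in\mathbb{R}^d\times\mathbb{R}^m$. The counting functions are $$N_A(Q,\delta,\bm{\theta})=\#\{(q,\bm{a})\in\mathbb{Z}\times\mathbb{Z}^{d}: \|(q,\bm{a}+\bm{\theta}^{(1)})A-\bm{\theta}^{(2)}\|<\delta,\ |(q,\bm{a})|<Q\},$$ $$N_A'(Q,\delta,\bm{\theta})=\sup_{q\in\mathbb{R}}\#\{\bm{a}\in\mathbb{Z}^d:\|(q,\bm{a}+\bm{\theta}^{(1)})A-\bm{\theta}^{(2)}\|<\delta,\ |\bm{a}|<Q\}.$$ *)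

theory Defs
  imports "HOL-Analysis.Analysis"
begin

text \<open>
  The sup norm is \<^const>\<open>infnorm\<close>. An index set of size \<open>d + 1\<close> is rendered as \<open>'d option\<close>, with
  \<open>None\<close> the index of the first coordinate (or row).
\<close>

definition vcons :: "'a \<Rightarrow> 'a ^ 'd \<Rightarrow> 'a ^ 'd option"
  where "vcons x v = (\<chi> i. case i of None \<Rightarrow> x | Some j \<Rightarrow> v $ j)"

definition real_vec :: "int ^ 'n \<Rightarrow> real ^ 'n"
  where "real_vec z = (\<chi> i. real_of_int (z $ i))"

definition int_dist :: "real ^ 'n \<Rightarrow> real"
  where "int_dist y = (INF z :: int ^ 'n. infnorm (y - real_vec z))"

definition badly_approximable :: "(real \<Rightarrow> real) \<Rightarrow> real ^ 'm ^ 'n \<Rightarrow> bool"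
  where "badly_approximable \<phi> B \<longleftrightarrow>
    (\<forall>q :: int ^ 'm. q \<noteq> 0 \<longrightarrow> int_dist (B *v real_vec q) \<ge> \<phi> (infnorm (real_vec q)))"

definition count_N ::
    "real ^ 'm ^ 'd option \<Rightarrow> real \<Rightarrow> real \<Rightarrow> (real ^ 'd) \<times> (real ^ 'm) \<Rightarrow> nat"
  where "count_N A Q \<delta> \<theta> = card {(q :: int, a :: int ^ 'd).
    int_dist (vcons (real_of_int q) (real_vec a + fst \<theta>) v* A - snd \<theta>) < \<delta> \<and>
    infnorm (real_vec (vcons q a)) < Q}"

text \<open>
  The supremum is taken in \<^typ>\<open>nat\<close>; the lemmas below show that it and the cardinalities are those
  of finite sets.
\<close>

definition count_N' ::
    "real ^ 'm ^ 'd option \<Rightarrow> real \<Rightarrow> real \<Rightarrow> (real ^ 'd) \<times> (real ^ 'm) \<Rightarrow> nat"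
  where "count_N' A Q \<delta> \<theta> = (SUP q :: real. card {a :: int ^ 'd.
    int_dist (vcons q (real_vec a + fst \<theta>) v* A - snd \<theta>) < \<delta> \<and>
    infnorm (real_vec a) < Q})"

definition C_const :: "nat \<Rightarrow> nat \<Rightarrow> real"
  where "C_const d m = 8 ^ d * pi ^ (2 * m)"

lemma finite_infnorm_less: "finite {a :: int ^ 'n. infnorm (real_vec a) < Q}"
proof -
  have "\<bar>a $ i\<bar> \<le> \<lceil>Q\<rceil>" if "infnorm (real_vec a) < Q" for a :: "int ^ 'n" and i
    using component_le_infnorm_cart[of "real_vec a" i] that
    by (simp add: real_vec_def) linarith
  then have "vec_nth ` {a :: int ^ 'n. infnorm (real_vec a) < Q} \<subseteq> (UNIV \<rightarrow>\<^sub>E {-\<lceil>Q\<rceil>..\<lceil>Q\<rceil>})"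
    by (auto simp: abs_le_iff) (smt (verit, best))+
  then have "finite (vec_nth ` {a :: int ^ 'n. infnorm (real_vec a) < Q})"
    by (rule finite_subset) (auto intro: finite_PiE)
  then show ?thesis
    by (rule finite_imageD) (auto simp: inj_on_def vec_eq_iff)
qed

lemma finite_count_N:
  "finite {(q :: int, a :: int ^ 'd).
    int_dist (vcons (real_of_int q) (real_vec a + fst \<theta>) v* A - snd \<theta>) < \<delta> \<and>
    infnorm (real_vec (vcons q a)) < Q}" (is "finite ?S")
proof -
  have "finite ((\<lambda>(q, a). vcons q a) ` ?S)"
    by (rule finite_subset[OF _ finite_infnorm_less[of Q]]) auto
  moreover have "inj (\<lambda>(q :: int, a :: int ^ 'd). vcons q a)"
  proof (rule injI, clarify)
    fix q q' :: int and a a' :: "int ^ 'd"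
    assume eq: "vcons q a = vcons q' a'"
    have "q = q'" using arg_cong[OF eq, of "\<lambda>v. v $ None"] by (simp add: vcons_def)
    moreover have "a $ i = a' $ i" for i
      using arg_cong[OF eq, of "\<lambda>v. v $ Some i"] by (simp add: vcons_def)
    ultimately show "q = q' \<and> a = a'" by (simp add: vec_eq_iff)
  qed
  ultimately show ?thesis
    by (metis (lifting) finite_imageD inj_on_subset subset_UNIV)
qed

lemma finite_range_count_N':
  "finite (range (\<lambda>q :: real. card {a :: int ^ 'd.
    int_dist (vcons q (real_vec a + fst \<theta>) v* A - snd \<theta>) < \<delta> \<and>
    infnorm (real_vec a) < Q}))"
  by (rule finite_subset[of _ "{..card {a :: int ^ 'd. infnorm (real_vec a) < Q}}"])
     (auto intro!: card_mono finite_infnorm_less)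

end

theory Submission
  imports Defs "HOL-Real_Asymp.Real_Asymp"
begin

text \<open>
  Both counts are instances of one problem: for a \<open>\<phi>\<close>-badly approximable matrix \<open>B\<close> with \<open>n\<close> rows and
  a shift \<open>y\<close>, count the integer vectors \<open>a\<close> with \<open>|a| < Q\<close> for which \<open>a B - y\<close> is within \<open>\<delta>\<close> of an
  integer vector (\<open>card_shifted_solutions_le\<close>). In both parts \<open>\<theta>\<close>, and in the second part also
  \<open>q \<beta>\<close>, only move \<open>y\<close>.

  Write \<open>e(x)\<close> for \<open>exp (2 \<pi> i x)\<close> and take \<open>N\<close> close to \<open>1 / (2 \<delta>)\<close>. If \<open>a\<close> is counted, then the
  exponential sum \<open>\<Sum> e(k \<bullet> (a B - y))\<close> over the cube \<open>{0..<N}\<^sup>m\<close> shows little cancellation: it is a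
  product of \<open>m\<close> one-dimensional geometric sums, each of modulus at least \<open>2 N / \<pi>\<close>
  (\<open>norm_dirichlet_ge\<close>). As \<open>k \<bullet> (a B) = a \<bullet> (B k)\<close>, this is also an exponential sum in \<open>a\<close> with
  frequencies \<open>B k\<close>. Distinct \<open>k\<close> differ by a nonzero vector of norm below \<open>1 / \<delta>\<close>, so by bad
  approximability and monotonicity the frequencies are \<open>\<phi> (1 / \<delta>)\<close>-separated modulo 1. Hence they
  are nearly orthogonal on the cube \<open>|a| < Q\<close>, which is quantified by a large sieve inequality in
  \<open>n\<close> dimensions (\<open>dual_large_sieve\<close>): the sum of the squared moduli over the cube is at most
  \<open>N\<^sup>m (const \<cdot> max Q (1 / \<phi> (1 / \<delta>)))\<^sup>n\<close>. Comparing the two bounds gives the theorem. The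
  factors \<open>\<pi>\<^sup>2\<close> per column come from \<open>(2 / \<pi>)\<^sup>2\<close> in the lower bound, and the factor per row obtained is
  \<open>\<pi>\<^sup>2 / 2\<close>, which is less than \<open>8\<close>.

  The large sieve inequality is proved by inserting a weight that is a product of Fejer kernels.
  Its Fourier transform is supported in a small cube, so it kills all off-diagonal terms. To
  have only finite sums, this is done for frequencies with a common denominator \<open>P\<close>, where
  the weight lives on the residues modulo \<open>P\<close> (\<open>dual_large_sieve_cyclic\<close>), and the general case
  follows by rounding the frequencies and letting \<open>P\<close> tend to infinity.
\<close>

section \<open>Additive characters and geometric sums\<close>

definition e :: "real \<Rightarrow> complex" where "e x = cis (2 * pi * x)"

lemma e_add: "e (x + y) = e x * e y"
  by (simp add: e_def cis_mult ring_distribs)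

lemma e_diff: "e (x - y) = e x * cnj (e y)"
  by (simp add: e_def cis_cnj cis_mult ring_distribs)

lemma e_of_int [simp]: "e (of_int n) = 1"
  by (simp add: e_def cis_multiple_2pi)

lemma norm_e [simp]: "norm (e x) = 1"
  by (simp add: e_def)

lemma e_0 [simp]: "e 0 = 1"
  by (simp add: e_def)

lemma e_eq_1_iff: "e x = 1 \<longleftrightarrow> x \<in> \<int>"
proof
  assume "e x = 1"
  then have "cos (2 * pi * x) = 1" by (simp add: e_def complex_eq_iff)
  then obtain n :: int where "2 * pi * x = of_int n * 2 * pi"
    by (auto simp: cos_one_2pi_int)
  then have "x = of_int n" by simp
  then show "x \<in> \<int>" by simp
qed (auto elim!: Ints_cases)

lemma e_sum: "finite A \<Longrightarrow> e (\<Sum>j\<in>A. f j) = (\<Prod>j\<in>A. e (f j))"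
  by (induction A rule: finite_induct) (auto simp: e_add)

lemma norm_e_minus_1: "norm (e x - 1) = 2 * \<bar>sin (pi * x)\<bar>"
proof -
  have "e x - 1 = cis (pi * x) * (cis (pi * x) - cis (- (pi * x)))"
    by (simp add: e_def cis_mult right_diff_distrib mult_ac)
  also have "cis (pi * x) - cis (- (pi * x)) = 2 * \<i> * complex_of_real (sin (pi * x))"
    by (simp add: complex_eq_iff)
  finally show ?thesis by (simp add: norm_mult)
qed

lemma geometric_e:
  "(e x - 1) * (\<Sum>t\<in>{a..<a + int n}. e (of_int t * x)) = e (of_int (a + int n) * x) - e (of_int a * x)"
proof (induction n)
  case (Suc n)
  have "{a..<a + int (Suc n)} = insert (a + int n) {a..<a + int n}" by auto
  then show ?case
    using Suc by (simp add: ring_distribs e_add)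
qed simp

definition dirichlet :: "nat \<Rightarrow> real \<Rightarrow> complex"
  where "dirichlet L x = (\<Sum>i\<in>{0..<int L}. e (of_int i * x))"

text \<open>The sine is concave on \<open>[0, \<pi>]\<close>, so it lies above the chord from \<open>0\<close> to \<open>\<pi> / 2\<close>.\<close>

lemma sin_ge_chord:
  assumes "0 \<le> x" "x \<le> pi / 2"
  shows "2 / pi * x \<le> sin x"
proof -
  have "convex_on {0..pi} (\<lambda>x. - sin x)"
    by (rule f''_ge0_imp_convex[where f' = "\<lambda>x. - cos x" and f'' = "\<lambda>x. sin x"])
       (auto intro!: derivative_eq_intros sin_ge_zero)
  from convex_onD[OF this, of "2 / pi * x" 0 "pi/2"] assms
  show ?thesis by (simp add: field_simps)
qed

text \<open>
  For nonintegral \<open>x\<close> the modulus is \<open>|sin (\<pi> L x)| / |sin (\<pi> x)|\<close>. The hypothesis keeps \<open>\<pi> L x\<close> inside the quarter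
  period where the chord bounds the numerator from below. The lemma serves twice: for the sum over
  \<open>k\<close> that detects the solutions, and for the weight in the large sieve.
\<close>

lemma norm_dirichlet_ge:
  assumes "real L * \<bar>x\<bar> \<le> 1 / 2"
  shows "2 * real L / pi \<le> norm (dirichlet L x)"
proof (cases "x = 0 \<or> L = 0")
  case True
  have "2 * real L / pi \<le> real L"
    using mult_left_mono[OF pi_ge_two, of "real L"] by (simp add: field_simps)
  with True show ?thesis by (auto simp: dirichlet_def)
next
  case False
  have "2 * (2 * real L * \<bar>x\<bar>) \<le> 2 * \<bar>sin (pi * (real L * x))\<bar>"
  proof -
    have "2 / pi * (pi * (real L * \<bar>x\<bar>)) \<le> sin (pi * (real L * \<bar>x\<bar>))"
      by (rule sin_ge_chord) (use assms in \<open>auto simp: field_simps\<close>)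
    also have "\<dots> \<le> \<bar>sin (pi * (real L * x))\<bar>"
      by (cases "x \<ge> 0") auto
    finally show ?thesis by (simp add: mult_ac)
  qed
  also have "\<dots> = norm (e x - 1) * norm (dirichlet L x)"
    using geometric_e[of x 0 L] by (simp add: dirichlet_def flip: norm_mult norm_e_minus_1)
  also have "\<dots> \<le> 2 * (pi * \<bar>x\<bar>) * norm (dirichlet L x)"
    using abs_sin_x_le_abs_x[of "pi * x"]
    by (intro mult_right_mono) (auto simp: norm_e_minus_1 abs_mult)
  finally have "\<bar>x\<bar> * (2 * real L) \<le> \<bar>x\<bar> * (pi * norm (dirichlet L x))"
    by (simp add: mult_ac)
  then have "2 * real L \<le> pi * norm (dirichlet L x)"
    using False by (subst (asm) mult_le_cancel_left_pos) auto
  then show ?thesis by (simp add: field_simps)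
qed

section \<open>Sums over cubes of integer vectors\<close>

lemma sum_box_prod:
  fixes f :: "'n :: finite \<Rightarrow> int \<Rightarrow> 'a :: comm_semiring_1"
  assumes "finite I"
  shows "(\<Sum>a | \<forall>j. a $ j \<in> I. \<Prod>j\<in>UNIV. f j (a $ j)) = (\<Prod>j\<in>UNIV. \<Sum>t\<in>I. f j t)"
proof -
  have "(\<Prod>j\<in>UNIV. \<Sum>t\<in>I. f j t) = (\<Sum>g\<in>UNIV \<rightarrow>\<^sub>E I. \<Prod>j\<in>UNIV. f j (g j))"
    using assms by (simp add: prod_sum_PiE)
  also have "\<dots> = (\<Sum>a | \<forall>j. a $ j \<in> I. \<Prod>j\<in>UNIV. f j (a $ j))"
    by (rule sum.reindex_bij_witness[of _ vec_nth vec_lambda]) (auto simp: PiE_iff)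
  finally show ?thesis ..
qed

lemma card_box:
  assumes "finite I"
  shows "card {a :: int ^ 'n. \<forall>j. a $ j \<in> I} = card I ^ CARD('n)"
  using sum_box_prod[OF assms, of "\<lambda>(_ :: 'n) _. 1 :: nat"] by simp

lemma finite_box:
  assumes "finite I"
  shows "finite {a :: int ^ 'n. \<forall>j. a $ j \<in> I}"
proof (cases "I = {}")
  case False
  then show ?thesis using assms card_box[OF assms, where 'n = 'n]
    by (intro card_ge_0_finite) (auto simp: card_gt_0_iff)
qed auto

section \<open>Fejer weights on residues\<close>

text \<open>
  Orthogonality of the additive characters modulo \<open>2 M\<close>. The symmetric system of residues is used
  because the weights below are large near \<open>0\<close>; the modulus is even to make it an interval
  \<open>[-M, M)\<close>.
\<close>

lemma sum_e_residues:
  assumes "0 < M" 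
  shows "(\<Sum>t\<in>{- int M..<int M}. e (of_int t * (of_int h / real (2 * M))))
    = (if int (2 * M) dvd h then of_nat (2 * M) else 0)"
proof (cases "int (2 * M) dvd h")
  case True
  then obtain z where "h = int (2 * M) * z" by blast
  then have "real_of_int t * (of_int h / real (2 * M)) = of_int (t * z)" for t
    using assms by simp
  then have "e (real_of_int t * (of_int h / real (2 * M))) = 1" for t
    by (metis e_of_int)
  with True show ?thesis by simp
next
  case False
  define x where "x = of_int h / real (2 * M)"
  have "x \<notin> \<int>"
  proof
    assume "x \<in> \<int>"
    then obtain z where "x = of_int z" by (rule Ints_cases)
    then have "real_of_int h = of_int (int (2 * M) * z)" using assms by (simp add: x_def field_simps)
    then have "h = int (2 * M) * z" using of_int_eq_iff by blast
    with False show False by simp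
  qed
  moreover have "e (real M * x) = e (real_of_int (- int M) * x)"
  proof -
    have "real M * x = real_of_int (- int M) * x + of_int h"
      using assms by (simp add: x_def field_simps)
    then show ?thesis by (simp only: e_add e_of_int mult_1_right)
  qed
  then have "(e x - 1) * (\<Sum>t\<in>{- int M..<int M}. e (of_int t * x)) = 0"
    using geometric_e[of x "- int M" "2 * M"] by simp
  ultimately show ?thesis using False by (simp add: e_eq_1_iff del: of_nat_mult flip: x_def)
qed

text \<open>
  Expanding the square gives a double sum over \<open>i, i'\<close>, and orthogonality picks the pairs with
  \<open>i' - i\<close> congruent to \<open>l\<close>. The point is that there is no such pair when \<open>l\<close> is at distance at least
  \<open>L\<close> from the multiples of \<open>2 M\<close>: the transform of the weight has small support.
\<close>

lemma fejer_fourier: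
  assumes "0 < M"
  shows "(\<Sum>t\<in>{- int M..<int M}. of_real ((norm (dirichlet L (of_int t / real (2 * M))))\<^sup>2)
      * e (of_int t * (of_int l / real (2 * M))))
    = of_nat (2 * M) * of_nat (card {(i, i'). i \<in> {0..<int L} \<and> i' \<in> {0..<int L} \<and> int (2 * M) dvd l + i - i'})"
proof -
  let ?P = "real (2 * M)" and ?I = "{0..<int L}"
  have "of_real ((norm (dirichlet L (of_int t / ?P)))\<^sup>2) * e (of_int t * (of_int l / ?P))
      = (\<Sum>i\<in>?I. \<Sum>i'\<in>?I. e (of_int t * (of_int (l + i - i') / ?P)))" for t
  proof -
    have "e (of_int t * (of_int (l + i - i') / ?P))
        = e (of_int i * (of_int t / ?P)) * cnj (e (of_int i' * (of_int t / ?P)))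
          * e (of_int t * (of_int l / ?P))" for i i'
      by (simp only: flip: e_diff e_add) (simp add: add_divide_distrib diff_divide_distrib algebra_simps)
    then show ?thesis
      by (simp only: complex_norm_square dirichlet_def cnj_sum sum_product)
         (simp only: sum_distrib_right)
  qed
  then have "(\<Sum>t\<in>{- int M..<int M}. of_real ((norm (dirichlet L (of_int t / ?P)))\<^sup>2)
      * e (of_int t * (of_int l / ?P)))
     = (\<Sum>t\<in>{- int M..<int M}. \<Sum>i\<in>?I. \<Sum>i'\<in>?I. e (of_int t * (of_int (l + i - i') / ?P)))"
    by simp
  also have "\<dots> = (\<Sum>i\<in>?I. \<Sum>t\<in>{- int M..<int M}. \<Sum>i'\<in>?I. e (of_int t * (of_int (l + i - i') / ?P)))"
    by (rule sum.swap)
  also have "\<dots> = (\<Sum>i\<in>?I. \<Sum>i'\<in>?I. \<Sum>t\<in>{- int M..<int M}. e (of_int t * (of_int (l + i - i') / ?P)))"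
    by (intro sum.cong refl sum.swap)
  also have "\<dots> = of_nat (2 * M) * of_nat (card {(i, i'). i \<in> ?I \<and> i' \<in> ?I \<and> int (2 * M) dvd l + i - i'})"
  proof -
    have "(\<Sum>i\<in>?I. \<Sum>i'\<in>?I. if int (2 * M) dvd l + i - i' then (of_nat (2 * M) :: complex) else 0)
      = (\<Sum>p\<in>?I\<times>?I. if p \<in> {(i, i'). int (2 * M) dvd l + i - i'} then of_nat (2 * M) else 0)"
      by (simp add: sum.cartesian_product case_prod_unfold)
    also have "\<dots> = (\<Sum>p\<in>(?I\<times>?I) \<inter> {(i, i'). int (2 * M) dvd l + i - i'}. of_nat (2 * M))"
      by (rule sum.inter_restrict[symmetric]) simp
    also have "(?I\<times>?I) \<inter> {(i, i'). int (2 * M) dvd l + i - i'} = {(i, i'). i \<in> ?I \<and> i' \<in> ?I \<and> int (2 * M) dvd l + i - i'}"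
      by auto
    finally show ?thesis
      by (simp only: sum_e_residues[OF assms]) simp
  qed
  finally show ?thesis .
qed


section \<open>A dual large sieve inequality\<close>

text \<open>
  The frequencies are \<open>l k / (2 M)\<close>, and separation is expressed as it is needed: in some coordinate
  no difference of two elements of \<open>{0..<L}\<close> is congruent to the difference of the frequencies. The
  weight \<open>W\<close> is bounded below on \<open>S\<close>, and its transform factorises over the coordinates, so one vanishing
  coordinate removes an off-diagonal pair. The full weighted sum over the residues is therefore
  exactly a multiple of the sum of the squares of the coefficients.
\<close>

lemma dual_large_sieve_cyclic:
  fixes c :: "'k \<Rightarrow> complex" and l :: "'k \<Rightarrow> int ^ 'n" and S :: "(int ^ 'n) set"
  assumes "finite K" and L: "0 < L" "L \<le> 2 * M"
    and S: "\<And>a j. a \<in> S \<Longrightarrow> int L * \<bar>a $ j\<bar> < int M"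
    and sep: "\<And>k k'. k \<in> K \<Longrightarrow> k' \<in> K \<Longrightarrow> k \<noteq> k' \<Longrightarrow>
      \<exists>j. \<forall>i\<in>{0..<int L}. \<forall>i'\<in>{0..<int L}. \<not> int (2 * M) dvd (l k - l k') $ j + i - i'"
  shows "(\<Sum>a\<in>S. (norm (\<Sum>k\<in>K. c k * e (real_vec a \<bullet> real_vec (l k) / real (2 * M))))\<^sup>2)
    \<le> (pi\<^sup>2 / 4 * (real (2 * M) / real L)) ^ CARD('n) * (\<Sum>k\<in>K. (norm (c k))\<^sup>2)"
proof -
  have M: "0 < M" using L by simp
  let ?P = "real (2 * M)" and ?T = "{- int M..<int M}" and ?n = "CARD('n)"
  define F where "F a = (\<Sum>k\<in>K. c k * e (real_vec a \<bullet> real_vec (l k) / ?P))" for a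
  define w where "w t = (norm (dirichlet L (of_int t / ?P)))\<^sup>2" for t :: int
  define W where "W a = (\<Prod>j\<in>UNIV. w (a $ j))" for a :: "int ^ 'n"
  define box where "box = {a :: int ^ 'n. \<forall>j. a $ j \<in> ?T}"
  have [simp]: "finite box" unfolding box_def by (rule finite_box) simp
  have "S \<subseteq> box"
  proof
    fix a assume "a \<in> S"
    have "\<bar>a $ j\<bar> < int M" for j
    proof -
      have "1 * \<bar>a $ j\<bar> \<le> int L * \<bar>a $ j\<bar>" using L by (intro mult_right_mono) auto
      then show ?thesis using S[OF \<open>a \<in> S\<close>, of j] by simp
    qed
    then show "a \<in> box" by (auto simp: box_def abs_less_iff) (smt (verit, best))+
  qed

  \<comment> \<open>The condition \<open>L \<le> 2 M\<close> makes the elements of \<open>{0..<L}\<close> incongruent, so \<open>h = 0\<close> has \<open>L\<close> pairs.\<close>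
  have w_hat: "(\<Sum>t\<in>?T. complex_of_real (w t) * e (of_int t * (of_int h / ?P)))
      = (if h = 0 then of_real (?P * real L) else 0)"
    if "h = 0 \<or> (\<forall>i\<in>{0..<int L}. \<forall>i'\<in>{0..<int L}. \<not> int (2 * M) dvd h + i - i')" for h
  proof -
    have "{(i, i'). i \<in> {0..<int L} \<and> i' \<in> {0..<int L} \<and> int (2 * M) dvd h + i - i'}
        = (if h = 0 then (\<lambda>i. (i, i)) ` {0..<int L} else {})"
    proof (cases "h = 0")
      case True
      have "i = i'" if "i \<in> {0..<int L}" "i' \<in> {0..<int L}" "int (2 * M) dvd i - i'" for i i'
      proof (rule ccontr)
        assume "i \<noteq> i'"
        then have "int (2 * M) \<le> \<bar>i - i'\<bar>"
          using dvd_imp_le_int[of "i - i'" "int (2 * M)"] that by simp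
        then show False using that L by auto
      qed
      with True show ?thesis by (auto simp: image_iff) blast+
    next
      case False
      with that show ?thesis by auto
    qed
    moreover have "card ((\<lambda>i. (i, i)) ` {0..<int L}) = L"
      by (subst card_image) (auto simp: inj_on_def)
    ultimately show ?thesis
      using fejer_fourier[OF M, of L h] by (auto simp: w_def)
  qed

  have pair: "(\<Sum>a\<in>box. complex_of_real (W a)
        * e (real_vec a \<bullet> real_vec (l k) / ?P - real_vec a \<bullet> real_vec (l k') / ?P))
      = (if k = k' then of_real ((?P * real L) ^ ?n) else 0)" if kk': "k \<in> K" "k' \<in> K" for k k'
  proof -
    let ?h = "\<lambda>j. (l k - l k') $ j"
    have "(\<Sum>a\<in>box. complex_of_real (W a)
        * e (real_vec a \<bullet> real_vec (l k) / ?P - real_vec a \<bullet> real_vec (l k') / ?P))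
      = (\<Sum>a\<in>box. \<Prod>j\<in>UNIV. complex_of_real (w (a $ j)) * e (of_int (a $ j) * (of_int (?h j) / ?P)))"
    proof (rule sum.cong[OF refl])
      fix a :: "int ^ 'n"
      have "real_vec a \<bullet> real_vec (l k) / ?P - real_vec a \<bullet> real_vec (l k') / ?P
          = (\<Sum>j\<in>UNIV. of_int (a $ j) * (of_int (?h j) / ?P))"
        by (simp add: inner_vec_def real_vec_def sum_divide_distrib right_diff_distrib
            diff_divide_distrib flip: sum_subtractf)
      then show "complex_of_real (W a)
          * e (real_vec a \<bullet> real_vec (l k) / ?P - real_vec a \<bullet> real_vec (l k') / ?P)
        = (\<Prod>j\<in>UNIV. complex_of_real (w (a $ j)) * e (of_int (a $ j) * (of_int (?h j) / ?P)))"
        by (simp only: W_def of_real_prod prod.distrib e_sum[OF finite])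
    qed
    also have "\<dots> = (\<Prod>j\<in>UNIV. \<Sum>t\<in>?T. complex_of_real (w t) * e (of_int t * (of_int (?h j) / ?P)))"
      unfolding box_def by (rule sum_box_prod) simp
    also have "\<dots> = (if k = k' then of_real ((?P * real L) ^ ?n) else 0)"
    proof (cases "k = k'")
      case True
      then show ?thesis by (simp add: w_hat[of 0, simplified])
    next
      case False
      then obtain j where j: "\<forall>i\<in>{0..<int L}. \<forall>i'\<in>{0..<int L}. \<not> int (2 * M) dvd ?h j + i - i'"
        using sep kk' by blast
      have "?h j \<noteq> 0"
        using j[rule_format, of 0 0] L by auto
      then have "(\<Sum>t\<in>?T. complex_of_real (w t) * e (of_int t * (of_int (?h j) / ?P))) = 0"
        using w_hat[of "?h j"] j by simp
      then show ?thesis using False by (auto intro!: prod_zero)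
    qed
    finally show ?thesis .
  qed

  have "complex_of_real (\<Sum>a\<in>box. W a * (norm (F a))\<^sup>2)
      = (\<Sum>a\<in>box. \<Sum>k\<in>K. \<Sum>k'\<in>K. c k * cnj (c k') * (of_real (W a)
          * e (real_vec a \<bullet> real_vec (l k) / ?P - real_vec a \<bullet> real_vec (l k') / ?P)))"
    unfolding of_real_sum of_real_mult complex_norm_square F_def cnj_sum sum_product
    unfolding sum_distrib_left e_diff complex_cnj_mult
    by (intro sum.cong refl) (simp add: mult_ac)
  also have "\<dots> = (\<Sum>k\<in>K. \<Sum>a\<in>box. \<Sum>k'\<in>K. c k * cnj (c k') * (of_real (W a)
          * e (real_vec a \<bullet> real_vec (l k) / ?P - real_vec a \<bullet> real_vec (l k') / ?P)))"
    by (rule sum.swap)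
  also have "\<dots> = (\<Sum>k\<in>K. \<Sum>k'\<in>K. c k * cnj (c k') * (\<Sum>a\<in>box. of_real (W a)
          * e (real_vec a \<bullet> real_vec (l k) / ?P - real_vec a \<bullet> real_vec (l k') / ?P)))"
    unfolding sum_distrib_left by (intro sum.cong refl sum.swap)
  also have "\<dots> = (\<Sum>k\<in>K. \<Sum>k'\<in>K. if k = k' then c k * cnj (c k') * of_real ((?P * real L) ^ ?n) else 0)"
    by (intro sum.cong refl, simp only: pair) simp
  also have "\<dots> = (\<Sum>k\<in>K. c k * cnj (c k) * of_real ((?P * real L) ^ ?n))"
    by (intro sum.cong refl) (simp only: sum.delta'[OF \<open>finite K\<close>] if_True)
  also have "\<dots> = of_real ((?P * real L) ^ ?n * (\<Sum>k\<in>K. (norm (c k))\<^sup>2))"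
    unfolding of_real_mult of_real_sum complex_norm_square sum_distrib_left
    by (intro sum.cong refl mult.commute)
  finally have total: "(\<Sum>a\<in>box. W a * (norm (F a))\<^sup>2) = (?P * real L) ^ ?n * (\<Sum>k\<in>K. (norm (c k))\<^sup>2)"
    by (simp only: of_real_eq_iff)

  have W_nonneg: "0 \<le> W a" for a
    by (auto simp: W_def w_def intro!: prod_nonneg)
  have W_ge: "((2 * real L / pi)\<^sup>2) ^ ?n \<le> W a" if "a \<in> S" for a
  proof -
    have "(2 * real L / pi)\<^sup>2 \<le> w (a $ j)" for j
    proof -
      have "real_of_int (int L * \<bar>a $ j\<bar>) < real_of_int (int M)"
        using S[OF that, of j] of_int_less_iff by blast
      then have "real L * \<bar>of_int (a $ j) / ?P\<bar> \<le> 1 / 2"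
        using M by (simp add: field_simps)
      then show ?thesis
        unfolding w_def by (intro power_mono norm_dirichlet_ge) auto
    qed
    then have "(\<Prod>j\<in>(UNIV :: 'n set). (2 * real L / pi)\<^sup>2) \<le> W a"
      unfolding W_def by (intro prod_mono) auto
    then show ?thesis by simp
  qed
  have "((2 * real L / pi)\<^sup>2) ^ ?n * (\<Sum>a\<in>S. (norm (F a))\<^sup>2) \<le> (\<Sum>a\<in>S. W a * (norm (F a))\<^sup>2)"
    unfolding sum_distrib_left by (intro sum_mono mult_right_mono W_ge) auto
  also have "\<dots> \<le> (\<Sum>a\<in>box. W a * (norm (F a))\<^sup>2)"
    using \<open>S \<subseteq> box\<close> W_nonneg by (intro sum_mono2) auto
  also note total
  also have "(?P * real L) ^ ?n = ((2 * real L / pi)\<^sup>2) ^ ?n * (pi\<^sup>2 / 4 * (?P / real L)) ^ ?n"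
  proof -
    have "(2 * real L / pi)\<^sup>2 * (pi\<^sup>2 / 4 * (?P / real L)) = ?P * real L"
      using L by (simp add: field_simps power2_eq_square)
    then show ?thesis
      using power_mult_distrib[of "(2 * real L / pi)\<^sup>2" "pi\<^sup>2 / 4 * (?P / real L)" ?n]
      by (simp only:)
  qed
  finally show ?thesis
    using L by (simp add: F_def mult.assoc)
qed

text \<open>
  Rounding the frequencies down to multiples of \<open>1 / P\<close> moves each difference by less than \<open>1 / P\<close>.
  Since \<open>|i - i'| \<le> L - 1\<close> for \<open>i, i' \<in> {0..<L}\<close>, the choice \<open>L = \<lfloor>P r\<rfloor>\<close> leaves just enough room for
  the rounded frequencies to be separated. Both sides then converge as \<open>P\<close> grows. The bound \<open>r \<le> 1\<close>
  makes \<open>L \<le> P\<close>; it excludes arbitrarily large \<open>r\<close> for a single frequency, where the separation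
  hypothesis is void.
\<close>

lemma dual_large_sieve:
  fixes c :: "'k \<Rightarrow> complex" and \<xi> :: "'k \<Rightarrow> real ^ 'n" and S :: "(int ^ 'n) set"
  assumes "finite K" and r: "0 < r" "r \<le> 1"
    and S: "\<And>a j. a \<in> S \<Longrightarrow> r * \<bar>of_int (a $ j)\<bar> < 1 / 2"
    and sep: "\<And>k k'. k \<in> K \<Longrightarrow> k' \<in> K \<Longrightarrow> k \<noteq> k' \<Longrightarrow>
      \<exists>j. \<forall>z :: int. r \<le> \<bar>\<xi> k $ j - \<xi> k' $ j - of_int z\<bar>"
  shows "(\<Sum>a\<in>S. (norm (\<Sum>k\<in>K. c k * e (real_vec a \<bullet> \<xi> k)))\<^sup>2)
    \<le> (pi\<^sup>2 / (4 * r)) ^ CARD('n) * (\<Sum>k\<in>K. (norm (c k))\<^sup>2)"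
proof -
  let ?P = "\<lambda>M. real (2 * M)"
  define L where "L M = nat \<lfloor>?P M * r\<rfloor>" for M
  define l where "l M k = (\<chi> j. \<lfloor>?P M * \<xi> k $ j\<rfloor>)" for M k
  have real_L: "real (L M) = of_int \<lfloor>?P M * r\<rfloor>" for M
    using r by (simp add: L_def)
  have L_le: "real (L M) \<le> ?P M * r" for M
    unfolding real_L by simp
  have floor_lim: "(\<lambda>M. of_int \<lfloor>?P M * x\<rfloor> / ?P M) \<longlonglongrightarrow> x" for x
    by real_asymp
  have discrete: "(\<Sum>a\<in>S. (norm (\<Sum>k\<in>K. c k * e (real_vec a \<bullet> real_vec (l M k) / ?P M)))\<^sup>2)
      \<le> (pi\<^sup>2 / 4 * (?P M / real (L M))) ^ CARD('n) * (\<Sum>k\<in>K. (norm (c k))\<^sup>2)"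
    if M: "1 / r < real M" for M
  proof (rule dual_large_sieve_cyclic)
    have M0: "0 < M" using M r by (cases M) (auto simp: divide_less_0_iff)
    have "1 \<le> ?P M * r" using M r by (simp add: field_simps)
    then show "0 < L M" by (simp add: L_def)
    have "?P M * r \<le> ?P M * 1" using r by (intro mult_left_mono) auto
    then show "L M \<le> 2 * M" using L_le[of M] by linarith
    fix a j assume "a \<in> S"
    have "real (L M) * \<bar>of_int (a $ j)\<bar> \<le> ?P M * r * \<bar>of_int (a $ j)\<bar>"
      using L_le by (intro mult_right_mono) auto
    also have "\<dots> < ?P M * (1 / 2)"
      using S[OF \<open>a \<in> S\<close>, of j] M0 unfolding mult.assoc by (intro mult_strict_left_mono) auto
    finally have "real_of_int (int (L M) * \<bar>a $ j\<bar>) < real_of_int (int M)" by simp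
    then show "int (L M) * \<bar>a $ j\<bar> < int M" by (simp only: of_int_less_iff)
  next
    fix k k' assume "k \<in> K" "k' \<in> K" "k \<noteq> k'"
    then obtain j where j: "\<And>z :: int. r \<le> \<bar>\<xi> k $ j - \<xi> k' $ j - of_int z\<bar>"
      using sep by blast
    have M0: "0 < M" using M r by (cases M) (auto simp: divide_less_0_iff)
    have "\<not> int (2 * M) dvd (l M k - l M k') $ j + i - i'"
      if i: "i \<in> {0..<int (L M)}" "i' \<in> {0..<int (L M)}" for i i'
    proof
      assume "int (2 * M) dvd (l M k - l M k') $ j + i - i'"
      then obtain z where "(l M k - l M k') $ j + i - i' = int (2 * M) * z" by blast
      then have "real_of_int ((l M k - l M k') $ j + i - i') = real_of_int (int (2 * M) * z)"
        by simp
      then have z: "of_int \<lfloor>?P M * \<xi> k $ j\<rfloor> - of_int \<lfloor>?P M * \<xi> k' $ j\<rfloor> + of_int i - of_int i'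
          = ?P M * of_int z"
        by (simp add: l_def)
      have "?P M * r \<le> ?P M * \<bar>\<xi> k $ j - \<xi> k' $ j - of_int z\<bar>"
        using j by (intro mult_left_mono) auto
      also have "\<dots> = \<bar>?P M * \<xi> k $ j - ?P M * \<xi> k' $ j - ?P M * of_int z\<bar>"
        using M0 by (simp add: abs_mult flip: right_diff_distrib)
      also have "\<dots> < real (L M)"
      proof -
        have "\<bar>real_of_int i' - of_int i\<bar> \<le> real (L M) - 1"
        proof -
          have "\<bar>i' - i\<bar> \<le> int (L M) - 1" using i by auto
          then show ?thesis by linarith
        qed
        moreover have "\<bar>?P M * \<xi> k $ j - of_int \<lfloor>?P M * \<xi> k $ j\<rfloor>
            - (?P M * \<xi> k' $ j - of_int \<lfloor>?P M * \<xi> k' $ j\<rfloor>)\<bar> < 1"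
          by linarith
        ultimately show ?thesis using z by linarith
      qed
      finally show False using L_le[of M] by simp
    qed
    then show "\<exists>j. \<forall>i\<in>{0..<int (L M)}. \<forall>i'\<in>{0..<int (L M)}.
        \<not> int (2 * M) dvd (l M k - l M k') $ j + i - i'" by blast
  qed (rule \<open>finite K\<close>)

  have "(\<lambda>M. real_vec a \<bullet> real_vec (l M k) / ?P M) \<longlonglongrightarrow> real_vec a \<bullet> \<xi> k" for a k
  proof -
    have "(\<lambda>M. \<Sum>j\<in>UNIV. of_int (a $ j) * (of_int \<lfloor>?P M * \<xi> k $ j\<rfloor> / ?P M))
        \<longlonglongrightarrow> (\<Sum>j\<in>UNIV. of_int (a $ j) * \<xi> k $ j)"
      by (intro tendsto_intros floor_lim)
    then show ?thesis
      by (simp add: inner_vec_def real_vec_def l_def sum_divide_distrib)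
  qed
  then have "(\<lambda>M. \<Sum>a\<in>S. (norm (\<Sum>k\<in>K. c k * e (real_vec a \<bullet> real_vec (l M k) / ?P M)))\<^sup>2)
      \<longlonglongrightarrow> (\<Sum>a\<in>S. (norm (\<Sum>k\<in>K. c k * e (real_vec a \<bullet> \<xi> k)))\<^sup>2)"
    unfolding e_def by (intro tendsto_intros)
  moreover have "(\<lambda>M. ?P M / real (L M)) \<longlonglongrightarrow> 1 / r"
    using tendsto_inverse[OF floor_lim[of r]] r by (simp add: real_L field_simps)
  then have "(\<lambda>M. (pi\<^sup>2 / 4 * (?P M / real (L M))) ^ CARD('n) * (\<Sum>k\<in>K. (norm (c k))\<^sup>2))
      \<longlonglongrightarrow> (pi\<^sup>2 / 4 * (1 / r)) ^ CARD('n) * (\<Sum>k\<in>K. (norm (c k))\<^sup>2)"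
    by (intro tendsto_mult_right tendsto_power tendsto_mult_left)
  moreover have "eventually (\<lambda>M. 1 / r < real M) sequentially"
    using filterlim_real_sequentially by (simp add: filterlim_at_top_dense)
  then have "eventually (\<lambda>M. (\<Sum>a\<in>S. (norm (\<Sum>k\<in>K. c k * e (real_vec a \<bullet> real_vec (l M k) / ?P M)))\<^sup>2)
      \<le> (pi\<^sup>2 / 4 * (?P M / real (L M))) ^ CARD('n) * (\<Sum>k\<in>K. (norm (c k))\<^sup>2)) sequentially"
    by eventually_elim (rule discrete)
  ultimately show ?thesis
    by (auto dest: tendsto_le[OF sequentially_bot])
qed


section \<open>Distance to the nearest integer vector\<close>

lemma infnorm_less_iff:
  fixes x :: "real ^ 'n"
  shows "infnorm x < c \<longleftrightarrow> (\<forall>j. \<bar>x $ j\<bar> < c)"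
proof -
  have "infnorm x = Max (range (\<lambda>j. \<bar>x $ j\<bar>))"
    unfolding infnorm_cart by (subst cSup_eq_Max[symmetric]) (auto intro: arg_cong[of _ _ Sup])
  then show ?thesis by simp
qed

lemma bdd_below_infnorm: "bdd_below (range (\<lambda>z :: int ^ 'n. infnorm (y - real_vec z)))"
  by (rule bdd_belowI2[of _ 0]) (simp add: infnorm_pos_le)

lemma int_dist_lessD:
  assumes "int_dist y < c"
  shows "\<exists>z :: int ^ 'n. \<forall>j. \<bar>y $ j - of_int (z $ j)\<bar> < c"
proof -
  obtain z :: "int ^ 'n" where "infnorm (y - real_vec z) < c"
    using assms unfolding int_dist_def by (subst (asm) cINF_less_iff) (auto simp: bdd_below_infnorm)
  then show ?thesis by (auto simp: infnorm_less_iff real_vec_def)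
qed

text \<open>
  The nearest integer vector is found coordinate by coordinate, so a large distance is caused by a
  single coordinate, the same for all integer vectors. This is the form of separation that the
  product weight of the large sieve can use.
\<close>

lemma int_dist_ge_coordinate:
  fixes y :: "real ^ 'n"
  assumes "c \<le> int_dist y"
  shows "\<exists>j. \<forall>z :: int. c \<le> \<bar>y $ j - of_int z\<bar>"
proof (rule ccontr)
  assume "\<nexists>j. \<forall>z :: int. c \<le> \<bar>y $ j - of_int z\<bar>"
  then obtain z :: "'n \<Rightarrow> int" where "\<And>j. \<bar>y $ j - of_int (z j)\<bar> < c"
    by (metis not_le)
  then have "infnorm (y - real_vec (vec_lambda z)) < c"
    by (simp add: infnorm_less_iff real_vec_def)
  moreover have "int_dist y \<le> infnorm (y - real_vec (vec_lambda z))"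
    unfolding int_dist_def by (rule cINF_lower[OF bdd_below_infnorm]) simp
  ultimately show False using assms by simp
qed

section \<open>Counting solutions\<close>

lemma dirichlet_shift_int: "dirichlet N (x - of_int z) = dirichlet N x"
proof -
  have "e (of_int i * (x - of_int z)) = e (of_int i * x)" for i :: int
  proof -
    have "real_of_int i * x = of_int i * (x - of_int z) + of_int (i * z)"
      by (simp add: algebra_simps)
    then show ?thesis by (simp only: e_add e_of_int mult_1_right)
  qed
  then show ?thesis by (simp add: dirichlet_def)
qed

text \<open>
  The large sieve is applied with separation \<open>r = min \<rho> (1 / (2 Q))\<close>, where \<open>\<rho> = \<phi> (1 / \<delta>)\<close>: the first
  term is what bad approximability provides, the second is what the length of the cube allows. Its
  inverse is at most twice the maximum in the claim. For \<open>\<delta> > 1 / 2\<close> no \<open>N \<ge> 1\<close> satisfies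
  \<open>N \<delta> \<le> 1 / 2\<close>, but then already the number of all \<open>a\<close> in the cube is small enough.
\<close>

lemma card_shifted_solutions_le:
  fixes B :: "real ^ 'm ^ 'n" and y :: "real ^ 'm"
  assumes pos: "\<And>t. t > 0 \<Longrightarrow> \<phi> t > 0"
    and anti: "antimono_on {0<..} \<phi>"
    and bad: "badly_approximable \<phi> B"
    and Q: "0 < Q" and \<delta>: "0 < \<delta>"
  shows "real (card {a :: int ^ 'n. int_dist (real_vec a v* B - y) < \<delta> \<and> infnorm (real_vec a) < real Q})
    \<le> C_const CARD('n) CARD('m) * \<delta> ^ CARD('m) * max (real Q) (1 / \<phi> (inverse \<delta>)) ^ CARD('n)"
proof -
  define S where "S = {a :: int ^ 'n. int_dist (real_vec a v* B - y) < \<delta> \<and> infnorm (real_vec a) < real Q}"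
  define \<rho> where "\<rho> = \<phi> (inverse \<delta>)"
  define R where "R = max (real Q) (1 / \<rho>)"
  let ?n = "CARD('n)" and ?m = "CARD('m)"
  have [simp]: "0 < \<rho>" using pos \<delta> by (simp add: \<rho>_def)
  have R: "0 < R" "real Q \<le> R" "1 / \<rho> \<le> R" using Q by (auto simp: R_def)
  have S_abs: "\<bar>a $ j\<bar> < int Q" if "a \<in> S" for a j
    using that by (auto simp: S_def infnorm_less_iff real_vec_def) (metis of_int_abs of_int_less_iff of_int_of_nat_eq)
  have pi_sq: "4 \<le> pi\<^sup>2" "pi\<^sup>2 \<le> 16"
    using power_mono[OF pi_ge_two, of 2] power_mono[of pi 4 2] pi_less_4 by auto

  have "real (card S) \<le> 8 ^ ?n * pi ^ (2 * ?m) * \<delta> ^ ?m * R ^ ?n"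
  proof (cases "\<delta> \<le> 1 / 2")
    case False
    have "S \<subseteq> {a. \<forall>j. a $ j \<in> {- int Q..<int Q}}"
    proof (intro subsetI CollectI allI)
      fix a j assume "a \<in> S"
      then show "a $ j \<in> {- int Q..<int Q}" using S_abs[of a j] by auto
    qed
    then have "card S \<le> card {a :: int ^ 'n. \<forall>j. a $ j \<in> {- int Q..<int Q}}"
      by (intro card_mono finite_box) auto
    also have "\<dots> = (2 * Q) ^ ?n"
      by (subst card_box) (auto simp: nat_mult_distrib simp flip: mult_2)
    finally have "real (card S) \<le> (2 * real Q) ^ ?n"
      by (metis of_nat_le_iff of_nat_mult of_nat_numeral of_nat_power)
    also have "\<dots> \<le> (8 * R) ^ ?n * 1"
      using R power_mono[of "2 * real Q" "8 * R" ?n] by simp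
    also have "\<dots> \<le> (8 * R) ^ ?n * (pi\<^sup>2 * \<delta>) ^ ?m"
    proof (intro mult_left_mono one_le_power)
      have "4 * (1 / 2) \<le> pi\<^sup>2 * \<delta>" using pi_sq False by (intro mult_mono) auto
      then show "1 \<le> pi\<^sup>2 * \<delta>" by simp
    qed (use R in simp)
    finally show ?thesis unfolding power_mult by (simp only: power_mult_distrib mult_ac)
  next
    case True
    define N where "N = nat \<lfloor>1 / (2 * \<delta>)\<rfloor>"
    have N: "1 \<le> N" "real N \<le> 1 / (2 * \<delta>)" "1 / (2 * \<delta>) < real N + 1"
    proof -
      have "1 \<le> 1 / (2 * \<delta>)" using True \<delta> by (simp add: field_simps)
      then have "1 \<le> \<lfloor>1 / (2 * \<delta>)\<rfloor>" by simp
      then show "1 \<le> N" "real N \<le> 1 / (2 * \<delta>)" "1 / (2 * \<delta>) < real N + 1"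
        unfolding N_def by linarith+
    qed
    have N\<delta>: "real N * \<delta> \<le> 1 / 2" "1 / real N \<le> 4 * \<delta>"
    proof -
      show "real N * \<delta> \<le> 1 / 2" using N \<delta> by (simp add: field_simps)
      have "1 / (2 * \<delta>) < 2 * real N" using N by linarith
      then show "1 / real N \<le> 4 * \<delta>" using N \<delta> by (simp add: field_simps)
    qed
    define K where "K = {k :: int ^ 'm. \<forall>j. k $ j \<in> {0..<int N}}"
    have [simp]: "finite K" unfolding K_def by (rule finite_box) simp
    have card_K: "card K = N ^ ?m" unfolding K_def by (subst card_box) auto
    define r where "r = min \<rho> (1 / (2 * real Q))"
    have r: "0 < r" "r \<le> 1" "r \<le> \<rho>" "r \<le> 1 / (2 * real Q)" using Q by (auto simp: r_def min_le_iff_disj)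
    have r_inv: "1 / r \<le> 2 * R"
      using R Q by (auto simp: r_def min_def) 
    define \<xi> where "\<xi> k = B *v real_vec k" for k
    define c where "c k = e (- (real_vec k \<bullet> y))" for k

    have sieve: "(\<Sum>a\<in>S. (norm (\<Sum>k\<in>K. c k * e (real_vec a \<bullet> \<xi> k)))\<^sup>2)
        \<le> (pi\<^sup>2 / (4 * r)) ^ ?n * (\<Sum>k\<in>K. (norm (c k))\<^sup>2)"
    proof (rule dual_large_sieve)
      fix a j assume "a \<in> S"
      have "real_of_int \<bar>a $ j\<bar> < real_of_int (int Q)"
        using S_abs[OF \<open>a \<in> S\<close>, of j] by (simp only: of_int_less_iff)
      then have "r * \<bar>of_int (a $ j)\<bar> < r * real Q" using r by simp
      also have "\<dots> \<le> 1 / (2 * real Q) * real Q" using r by (intro mult_right_mono) auto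
      finally show "r * \<bar>of_int (a $ j)\<bar> < 1 / 2" using Q by simp
    next
      fix k k' assume k: "k \<in> K" "k' \<in> K" "k \<noteq> k'"
      let ?q = "real_vec (k - k')"
      have "?q \<noteq> 0"
        using k by (auto simp: real_vec_def vec_eq_iff)
      then have "0 < infnorm ?q" by (simp add: infnorm_pos_lt)
      moreover have "infnorm ?q < inverse \<delta>"
        unfolding infnorm_less_iff
      proof
        fix j
        have "\<bar>(k - k') $ j\<bar> < int N"
          using k by (auto simp: K_def abs_less_iff) (smt (verit, best))+
        then have "real_of_int \<bar>(k - k') $ j\<bar> < real_of_int (int N)"
          by (simp only: of_int_less_iff)
        also have "\<dots> \<le> inverse \<delta>"
        proof -
          have "real N \<le> inverse \<delta> / 2" using N by (simp add: field_simps)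
          also have "\<dots> \<le> inverse \<delta>" using \<delta> by simp
          finally show ?thesis by simp
        qed
        finally show "\<bar>?q $ j\<bar> < inverse \<delta>" by (simp add: real_vec_def)
      qed
      ultimately have "\<rho> \<le> \<phi> (infnorm ?q)"
        unfolding \<rho>_def using \<delta> by (intro monotone_onD[OF anti]) auto
      also have "\<dots> \<le> int_dist (B *v ?q)"
        using bad k by (simp add: badly_approximable_def)
      also have "B *v ?q = \<xi> k - \<xi> k'"
        unfolding \<xi>_def matrix_vector_mult_diff_distrib[symmetric]
        by (rule arg_cong[of _ _ "\<lambda>v. B *v v"]) (simp add: real_vec_def vec_eq_iff)
      finally obtain j where "\<forall>z :: int. \<rho> \<le> \<bar>(\<xi> k - \<xi> k') $ j - of_int z\<bar>"
        using int_dist_ge_coordinate by blast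
      then show "\<exists>j. \<forall>z :: int. r \<le> \<bar>\<xi> k $ j - \<xi> k' $ j - of_int z\<bar>"
        using r by (intro exI[of _ j]) (auto intro: order_trans)
    qed (use r in auto)

    \<comment> \<open>For a solution the sum is a product of Dirichlet kernels near integers.\<close>
    have large: "((2 * real N / pi) ^ ?m)\<^sup>2 \<le> (norm (\<Sum>k\<in>K. c k * e (real_vec a \<bullet> \<xi> k)))\<^sup>2"
      if "a \<in> S" for a
    proof -
      define x where "x = real_vec a v* B - y"
      have "int_dist x < \<delta>"
        using \<open>a \<in> S\<close> by (simp add: S_def x_def)
      then obtain z :: "int ^ 'm" where z: "\<And>j. \<bar>x $ j - of_int (z $ j)\<bar> < \<delta>"
        using int_dist_lessD by blast
      have "c k * e (real_vec a \<bullet> \<xi> k) = (\<Prod>j\<in>UNIV. e (of_int (k $ j) * x $ j))" for k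
      proof -
        have "- (real_vec k \<bullet> y) + real_vec a \<bullet> \<xi> k = real_vec k \<bullet> x"
          by (simp add: x_def \<xi>_def inner_diff_right inner_commute[of _ "real_vec k"]
              flip: dot_lmul_matrix)
        also have "\<dots> = (\<Sum>j\<in>UNIV. of_int (k $ j) * x $ j)"
          by (simp add: inner_vec_def real_vec_def)
        finally show ?thesis
          by (simp add: c_def e_sum flip: e_add)
      qed
      then have "(\<Sum>k\<in>K. c k * e (real_vec a \<bullet> \<xi> k))
          = (\<Sum>k\<in>K. \<Prod>j\<in>UNIV. e (of_int (k $ j) * x $ j))"
        by (intro sum.cong refl)
      also have "\<dots> = (\<Prod>j\<in>UNIV. dirichlet N (x $ j))"
        unfolding K_def dirichlet_def
        by (rule sum_box_prod[where f = "\<lambda>j t. e (of_int t * x $ j)"]) simp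
      also have "norm \<dots> = (\<Prod>j\<in>UNIV. norm (dirichlet N (x $ j - of_int (z $ j))))"
        by (simp add: prod_norm dirichlet_shift_int)
      also have "\<dots> \<ge> (\<Prod>j\<in>(UNIV :: 'm set). 2 * real N / pi)"
      proof (intro prod_mono conjI norm_dirichlet_ge)
        fix j
        have "real N * \<bar>x $ j - of_int (z $ j)\<bar> \<le> real N * \<delta>"
          using z[of j] by (intro mult_left_mono) auto
        then show "real N * \<bar>x $ j - of_int (z $ j)\<bar> \<le> 1 / 2" using N\<delta> by simp
      qed auto
      finally show ?thesis by (intro power_mono) auto
    qed
    have "real (card S) * ((2 * real N / pi) ^ ?m)\<^sup>2 \<le> (\<Sum>a\<in>S. (norm (\<Sum>k\<in>K. c k * e (real_vec a \<bullet> \<xi> k)))\<^sup>2)"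
      using sum_mono[OF large] by simp
    also note sieve
    also have "(\<Sum>k\<in>K. (norm (c k))\<^sup>2) = real N ^ ?m"
      by (simp add: c_def card_K)
    also have "real N ^ ?m = ((2 * real N / pi) ^ ?m)\<^sup>2 * (pi\<^sup>2 / 4 * (1 / real N)) ^ ?m"
    proof -
      have "((2 * real N / pi) ^ ?m)\<^sup>2 = ((2 * real N / pi)\<^sup>2) ^ ?m"
        unfolding power_mult[symmetric] by (simp only: mult.commute)
      moreover have "(2 * real N / pi)\<^sup>2 * (pi\<^sup>2 / 4 * (1 / real N)) = real N"
        using N by (simp add: field_simps power2_eq_square)
      ultimately show ?thesis
        using power_mult_distrib[of "(2 * real N / pi)\<^sup>2" "pi\<^sup>2 / 4 * (1 / real N)" ?m]
        by (simp only:)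
    qed
    finally have "((2 * real N / pi) ^ ?m)\<^sup>2 * real (card S)
        \<le> ((2 * real N / pi) ^ ?m)\<^sup>2 * ((pi\<^sup>2 / (4 * r)) ^ ?n * (pi\<^sup>2 / 4 * (1 / real N)) ^ ?m)"
      by (simp only: mult_ac)
    then have "real (card S) \<le> (pi\<^sup>2 / (4 * r)) ^ ?n * (pi\<^sup>2 / 4 * (1 / real N)) ^ ?m"
      by (rule mult_left_le_imp_le) (use N in simp)
    also have "\<dots> \<le> (8 * R) ^ ?n * (pi\<^sup>2 * \<delta>) ^ ?m"
    proof -
      have "pi\<^sup>2 / (4 * r) = pi\<^sup>2 / 4 * (1 / r)" by simp
      also have "\<dots> \<le> 4 * (2 * R)" using pi_sq r_inv r by (intro mult_mono) auto
      finally have "(pi\<^sup>2 / (4 * r)) ^ ?n \<le> (8 * R) ^ ?n"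
        using r by (intro power_mono) auto
      moreover have "pi\<^sup>2 / 4 * (1 / real N) \<le> pi\<^sup>2 / 4 * (4 * \<delta>)"
        using N\<delta> by (intro mult_left_mono) auto
      then have "(pi\<^sup>2 / 4 * (1 / real N)) ^ ?m \<le> (pi\<^sup>2 * \<delta>) ^ ?m"
        by (intro power_mono) auto
      ultimately show ?thesis using R by (intro mult_mono) auto
    qed
    finally show ?thesis unfolding power_mult by (simp only: power_mult_distrib mult_ac)
  qed
  then show ?thesis
    by (simp add: S_def R_def \<rho>_def C_const_def)
qed

theorem theorem3p1:
  fixes \<phi> :: "real \<Rightarrow> real"
    and \<theta> :: "(real ^ 'd) \<times> (real ^ 'm)"
    and \<beta> :: "real ^ 'm"
    and A' :: "real ^ 'm ^ 'd"
    and A :: "real ^ 'm ^ 'd option"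
  assumes "\<And>t. t > 0 \<Longrightarrow> \<phi> t > 0"
    and "antimono_on {0<..} \<phi>"
    and "A = vcons \<beta> A'"
  shows "(badly_approximable \<phi> A \<longrightarrow>
      (\<forall>(Q::nat) (\<delta>::real). Q > 0 \<longrightarrow> \<delta> > 0 \<longrightarrow>
        real (count_N A (real Q) \<delta> \<theta>)
          \<le> C_const (CARD('d) + 1) CARD('m) * \<delta> ^ CARD('m)
             * max (real Q) (1 / \<phi> (inverse \<delta>)) ^ (CARD('d) + 1)))
    \<and> (badly_approximable \<phi> A' \<longrightarrow>
      (\<forall>(Q::nat) (\<delta>::real). Q > 0 \<longrightarrow> \<delta> > 0 \<longrightarrow>
        real (count_N' A (real Q) \<delta> \<theta>)
          \<le> C_const CARD('d) CARD('m) * \<delta> ^ CARD('m)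
             * max (real Q) (1 / \<phi> (inverse \<delta>)) ^ CARD('d)))"
proof (intro conjI impI allI)
  fix Q :: nat and \<delta> :: real
  assume bad: "badly_approximable \<phi> A" and "0 < Q" "0 < \<delta>"
  define y where "y = snd \<theta> - vcons 0 (fst \<theta>) v* A"
  define S where "S = {a. int_dist (real_vec a v* A - y) < \<delta> \<and> infnorm (real_vec a) < real Q}"
  have shift: "vcons (real_of_int q) (real_vec a + fst \<theta>) v* A - snd \<theta> = real_vec (vcons q a) v* A - y" for q a
  proof -
    have "vcons (real_of_int q) (real_vec a + fst \<theta>) = real_vec (vcons q a) + vcons 0 (fst \<theta>)"
      by (auto simp: vcons_def real_vec_def vec_eq_iff split: option.split)
    then show ?thesis by (simp add: y_def vector_matrix_left_distrib)
  qed
  have split_vec: "vcons (v $ None) (\<chi> j. v $ Some j) = v" for v :: "int ^ 'd option"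
    by (auto simp: vcons_def vec_eq_iff split: option.split)
  have "count_N A (real Q) \<delta> \<theta> = card S"
    unfolding count_N_def shift
  proof (rule bij_betw_same_card[of "\<lambda>(q, a). vcons q a"], rule bij_betw_byWitness[where f' = "\<lambda>v. (v $ None, \<chi> j. v $ Some j)"])
  qed (auto simp: S_def split_vec, auto simp: vcons_def vec_eq_iff)
  then show "real (count_N A (real Q) \<delta> \<theta>) \<le> C_const (CARD('d) + 1) CARD('m) * \<delta> ^ CARD('m)
      * max (real Q) (1 / \<phi> (inverse \<delta>)) ^ (CARD('d) + 1)"
    using card_shifted_solutions_le[OF assms(1,2) bad \<open>0 < Q\<close> \<open>0 < \<delta>\<close>, of y] by (simp add: S_def)
next
  fix Q :: nat and \<delta> :: real
  assume bad: "badly_approximable \<phi> A'" and "0 < Q" "0 < \<delta>"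
  let ?count = "\<lambda>q :: real. card {a :: int ^ 'd.
    int_dist (vcons q (real_vec a + fst \<theta>) v* A - snd \<theta>) < \<delta> \<and> infnorm (real_vec a) < real Q}"
  \<comment> \<open>The range is finite, so the supremum is attained and one real \<open>q\<close> has to be treated.\<close>
  have "Sup (range ?count) \<in> range ?count"
    using finite_range_count_N'[of \<theta> A \<delta> "real Q"] by (subst cSup_eq_Max) (auto intro!: Max_in)
  then obtain q where q: "count_N' A (real Q) \<delta> \<theta> = ?count q"
    by (auto simp: count_N'_def)
  define y where "y = snd \<theta> - fst \<theta> v* A' - q *\<^sub>R \<beta>"
  have "vcons q (real_vec a + fst \<theta>) v* A - snd \<theta> = real_vec a v* A' - y" for a
  proof -
    have "vcons q v v* A = q *\<^sub>R \<beta> + v v* A'" for v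
      by (simp add: vec_eq_iff vector_matrix_mult_def UNIV_option_conv sum.reindex assms(3) vcons_def mult_ac)
    then show ?thesis by (simp add: y_def vector_matrix_left_distrib)
  qed
  then show "real (count_N' A (real Q) \<delta> \<theta>) \<le> C_const CARD('d) CARD('m) * \<delta> ^ CARD('m)
      * max (real Q) (1 / \<phi> (inverse \<delta>)) ^ CARD('d)"
    using card_shifted_solutions_le[OF assms(1,2) bad \<open>0 < Q\<close> \<open>0 < \<delta>\<close>, of y] by (simp add: q)
qed

end
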